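(* Let $n\ge 1$, let $G=(V,E)$ be a finite graph, and let $p:V\to\mathbb{S}^n_+$. Then the framework $G(p)$ is first-order rigid in $\mathbb{S}^n_+$ if and only if the framework $G(\psi\circ p)$ is first-order rigid in $\mathbb{E}^n$, where $\psi:\mathbb{S}^n_+\to\mathbb{E}^n$, $\psi(x)=x/(\mathbf{e}\cdot x)$.
   Context: Here $x\cdot y$ is the standard inner product on $\mathbb{R}^{n+1}$ and $\mathbf{e}=(0,\dots,0,1)\in\mathbb{R}^{n+1}$. Define $\mathbb{E}^n=\{x\in\mathbb{R}^{n+1}: \mathbf{e}\cdot x=1\}$ and $\mathbb{S}^n_+=\{x\in\mathbb{R}^{n+1}: x\cdot x=1,\ \mathbf{e}\cdot x>0\}$. A graph $G=(V,E)$ has finite vertex set $V$ and an edge set $E$ of unordered pairs of distinct vertices. A bar-and-joint framework $G(p)$ in $\mathbb{E}^n$ (resp. $\mathbb{S}^n_+$) is a graph $G$ together with a map $p:V\to\mathbb{E}^n$ (resp. $p:V\to\mathbb{S}^n_+$); write $p_i=p(i)$, $u_i=u(i)$. A first-order motion of $G(p)$ in $\mathbb{E}^n$ is a map $u:V\to\mathbb{R}^{n+1}$ with $(p_i-p_j)\cdot(u_i-u_j)=0$ for all $\{i,j\}\in E$ and $\mathbf{e}\cdot u_k=0$ for all $k\in V$. A trivial first-order motion of $\mathbb{E}^n$ is a map $u:\mathbb{E}^n\to\mathbb{R}^{n+1}$ with $(x-y)\cdot(u(x)-u(y))=0$ and $\mathbf{e}\cdot u(z)=0$ for all $x,y,z\in\mathbb{E}^n$.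 A first-order motion of $G(p)$ in $\mathbb{S}^n_+$ is a map $u:V\to\mathbb{R}^{n+1}$ with $p_i\cdot u_j+p_j\cdot u_i=0$ for all $\{i,j\}\in E$ and $p_k\cdot u_k=0$ for all $k\in V$. A trivial first-order motion of $\mathbb{S}^n_+$ is a map $u:\mathbb{S}^n_+\to\mathbb{R}^{n+1}$ with $x\cdot u(y)+y\cdot u(x)=0$ and $z\cdot u(z)=0$ for all $x,y,z\in\mathbb{S}^n_+$. In either space, $G(p)$ is first-order rigid if every first-order motion $u$ of $G(p)$ is the restriction of a trivial first-order motion $w$ of the space, i.e. $u_i=w(p_i)$ for all $i\in V$. *)

theory Defs
  imports "HOL-Analysis.Analysis"
begin

text \<open>
  With \<open>n = CARD('n)\<close>, an arbitrary positive number, \<open>\<real>\<^sup>n\<^sup>+\<^sup>1\<close> is the Euclidean space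
  \<open>(real ^ 'n) \<times> real\<close>: the second component is the last coordinate, and the library inner
  product \<open>\<bullet>\<close> on this product is the standard one.
\<close>

definition ee :: "(real ^ 'n) \<times> real" where
  "ee = (0, 1)"

definition affine_space :: "((real ^ 'n) \<times> real) set" where
  "affine_space = {x. ee \<bullet> x = 1}"

definition upper_hemisphere :: "((real ^ 'n) \<times> real) set" where
  "upper_hemisphere = {x. x \<bullet> x = 1 \<and> ee \<bullet> x > 0}"

definition finite_graph :: "'v set \<Rightarrow> 'v set set \<Rightarrow> bool" where
  "finite_graph V E \<longleftrightarrow> finite V \<and> (\<forall>e\<in>E. \<exists>i\<in>V. \<exists>j\<in>V. i \<noteq> j \<and> e = {i, j})"

text \<open>
  A map defined on the vertex set (or on one of the two spaces) is given by a total function, of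
  which only the values on that set are ever constrained or used.
\<close>

definition first_order_motion_E ::
  "'v set \<Rightarrow> 'v set set \<Rightarrow> ('v \<Rightarrow> (real ^ 'n) \<times> real) \<Rightarrow> ('v \<Rightarrow> (real ^ 'n) \<times> real) \<Rightarrow> bool" where
  "first_order_motion_E V E p u \<longleftrightarrow>
     (\<forall>i j. {i, j} \<in> E \<longrightarrow> (p i - p j) \<bullet> (u i - u j) = 0) \<and>
     (\<forall>k\<in>V. ee \<bullet> u k = 0)"

definition trivial_motion_E :: "((real ^ 'n) \<times> real \<Rightarrow> (real ^ 'n) \<times> real) \<Rightarrow> bool" where
  "trivial_motion_E w \<longleftrightarrow>
     (\<forall>x\<in>affine_space. \<forall>y\<in>affine_space. (x - y) \<bullet> (w x - w y) = 0) \<and>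
     (\<forall>z\<in>affine_space. ee \<bullet> w z = 0)"

definition first_order_rigid_E ::
  "'v set \<Rightarrow> 'v set set \<Rightarrow> ('v \<Rightarrow> (real ^ 'n) \<times> real) \<Rightarrow> bool" where
  "first_order_rigid_E V E p \<longleftrightarrow>
     (\<forall>u. first_order_motion_E V E p u \<longrightarrow>
        (\<exists>w. trivial_motion_E w \<and> (\<forall>i\<in>V. u i = w (p i))))"

definition first_order_motion_S ::
  "'v set \<Rightarrow> 'v set set \<Rightarrow> ('v \<Rightarrow> (real ^ 'n) \<times> real) \<Rightarrow> ('v \<Rightarrow> (real ^ 'n) \<times> real) \<Rightarrow> bool" where
  "first_order_motion_S V E p u \<longleftrightarrow>
     (\<forall>i j. {i, j} \<in> E \<longrightarrow> p i \<bullet> u j + p j \<bullet> u i = 0) \<and>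
     (\<forall>k\<in>V. p k \<bullet> u k = 0)"

definition trivial_motion_S :: "((real ^ 'n) \<times> real \<Rightarrow> (real ^ 'n) \<times> real) \<Rightarrow> bool" where
  "trivial_motion_S w \<longleftrightarrow>
     (\<forall>x\<in>upper_hemisphere. \<forall>y\<in>upper_hemisphere. x \<bullet> w y + y \<bullet> w x = 0) \<and>
     (\<forall>z\<in>upper_hemisphere. z \<bullet> w z = 0)"

definition first_order_rigid_S ::
  "'v set \<Rightarrow> 'v set set \<Rightarrow> ('v \<Rightarrow> (real ^ 'n) \<times> real) \<Rightarrow> bool" where
  "first_order_rigid_S V E p \<longleftrightarrow>
     (\<forall>u. first_order_motion_S V E p u \<longrightarrow>
        (\<exists>w. trivial_motion_S w \<and> (\<forall>i\<in>V. u i = w (p i))))"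

definition central_proj :: "(real ^ 'n) \<times> real \<Rightarrow> (real ^ 'n) \<times> real" where
  "central_proj x = x /\<^sub>R (ee \<bullet> x)"

end

theory Submission
  imports Defs
begin

text \<open>
  Central projection carries first-order motions to first-order motions bijectively, one point
  at a time. Let \<open>x\<close> lie on the hemisphere, at height \<open>a = ee \<bullet> x\<close>, and let \<open>u\<close> be a velocity
  tangent to the sphere at \<open>x\<close>. Deleting the vertical part of \<open>u\<close> and dividing by \<open>a\<close> gives a
  horizontal velocity at \<open>central_proj x\<close>, and this is a linear isomorphism between the two tangent
  spaces (\<open>to_sphere_to_flat\<close>, \<open>to_flat_to_sphere\<close>). The scaling is chosen so that, for any two
  points, the expression in the length constraint of the flat space is the one of the
  hemisphere multiplied by a nonzero factor (\<open>edge_constraint_scaling\<close>).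

  Being a motion is a condition on single points and on pairs of points, so the isomorphism
  turns motions of \<open>G(p)\<close> into motions of \<open>G(central_proj \<circ> p)\<close> and back. A trivial motion satisfies the same
  conditions at all points and pairs of points of the space. Since \<open>central_proj\<close> is a bijection
  from the hemisphere onto the affine space, with inverse \<open>sgn\<close>, trivial motions correspond in the
  same way. Rigidity therefore transfers by moving a motion to the other space, extending it
  there, and moving the extension back.
\<close>

section \<open>Velocities under central projection\<close>

definition to_flat ::
  "(real ^ 'n) \<times> real \<Rightarrow> (real ^ 'n) \<times> real \<Rightarrow> (real ^ 'n) \<times> real" where
  "to_flat x u = (u - (ee \<bullet> u) *\<^sub>R ee) /\<^sub>R (ee \<bullet> x)"

text \<open>The vertical correction is the one that makes the result orthogonal to \<open>x\<close>.\<close>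

definition to_sphere ::
  "(real ^ 'n) \<times> real \<Rightarrow> (real ^ 'n) \<times> real \<Rightarrow> (real ^ 'n) \<times> real" where
  "to_sphere x v = (ee \<bullet> x) *\<^sub>R (v - (central_proj x \<bullet> v) *\<^sub>R ee)"

lemma ee_inner_ee: "ee \<bullet> ee = 1"
  by (simp add: ee_def)

lemma hemisphere_height_pos: "x \<in> upper_hemisphere \<Longrightarrow> ee \<bullet> x > 0"
  by (simp add: upper_hemisphere_def)

lemma ee_inner_to_flat: "ee \<bullet> to_flat x u = 0"
  by (simp add: to_flat_def inner_diff_right ee_inner_ee)

lemma inner_to_sphere:
  assumes "ee \<bullet> x > 0"
  shows "x \<bullet> to_sphere x v = 0"
  using assms
  by (simp add: to_sphere_def central_proj_def inner_diff_right inner_commute[of x ee])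

lemma to_flat_to_sphere:
  assumes "ee \<bullet> x > 0" and "ee \<bullet> v = 0"
  shows "to_flat x (to_sphere x v) = v"
  using assms
  by (simp add: to_flat_def to_sphere_def inner_diff_right ee_inner_ee algebra_simps)

lemma central_proj_inner_to_flat:
  assumes "ee \<bullet> x > 0"
  shows "central_proj x \<bullet> to_flat y w = ((x \<bullet> w) / (ee \<bullet> x) - ee \<bullet> w) / (ee \<bullet> y)"
  using assms
  by (simp add: central_proj_def to_flat_def inner_diff_right inner_commute[of x ee] divide_simps)

lemma to_sphere_to_flat:
  assumes "ee \<bullet> x > 0" and "x \<bullet> u = 0"
  shows "to_sphere x (to_flat x u) = u"
proof -
  have "central_proj x \<bullet> to_flat x u = - (ee \<bullet> u) / (ee \<bullet> x)"
    using assms by (simp add: central_proj_inner_to_flat)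
  moreover have "(ee \<bullet> x) *\<^sub>R to_flat x u = u - (ee \<bullet> u) *\<^sub>R ee"
    using assms by (simp add: to_flat_def)
  ultimately show ?thesis
    using assms by (simp add: to_sphere_def scaleR_add_right)
qed

text \<open>
  Tangency turns the diagonal terms on the left into the quotients \<open>- (ee \<bullet> u) / (ee \<bullet> x)\<close> and
  \<open>- (ee \<bullet> w) / (ee \<bullet> y)\<close>, which cancel the vertical contributions to the mixed terms; what
  remains is the spherical constraint.
\<close>

lemma edge_constraint_scaling:
  assumes "ee \<bullet> x > 0" "ee \<bullet> y > 0" and "x \<bullet> u = 0" "y \<bullet> w = 0"
  shows "(central_proj x - central_proj y) \<bullet> (to_flat x u - to_flat y w)
           = - (x \<bullet> w + y \<bullet> u) / ((ee \<bullet> x) * (ee \<bullet> y))"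
  unfolding inner_diff_left inner_diff_right
  using assms by (simp add: central_proj_inner_to_flat field_simps)

lemma edge_constraint_to_flat:
  assumes "x \<in> upper_hemisphere" "y \<in> upper_hemisphere"
    and "x \<bullet> u = 0" "y \<bullet> w = 0"
  shows "(central_proj x - central_proj y) \<bullet> (to_flat x u - to_flat y w) = 0
           \<longleftrightarrow> x \<bullet> w + y \<bullet> u = 0"
proof -
  have "ee \<bullet> x > 0" "ee \<bullet> y > 0"
    using assms(1,2) by (simp_all add: hemisphere_height_pos)
  then show ?thesis
    using edge_constraint_scaling[of x y u w] assms by auto
qed

lemma edge_constraint_to_sphere:
  assumes "x \<in> upper_hemisphere" "y \<in> upper_hemisphere"
    and "ee \<bullet> v = 0" "ee \<bullet> w = 0"
  shows "x \<bullet> to_sphere y w + y \<bullet> to_sphere x v = 0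
           \<longleftrightarrow> (central_proj x - central_proj y) \<bullet> (v - w) = 0"
  using edge_constraint_to_flat[of x y "to_sphere x v" "to_sphere y w"] assms
  by (simp add: hemisphere_height_pos inner_to_sphere to_flat_to_sphere)

section \<open>Motions of frameworks\<close>

lemma graph_edge_vertices:
  assumes "finite_graph V E" "{i, j} \<in> E"
  shows "i \<in> V" "j \<in> V"
  using assms by (auto simp: finite_graph_def doubleton_eq_iff)

lemma first_order_motion_to_flat:
  assumes "finite_graph V E" "p \<in> V \<rightarrow> upper_hemisphere" "first_order_motion_S V E p u"
  shows "first_order_motion_E V E (central_proj \<circ> p) (\<lambda>i. to_flat (p i) (u i))"
proof -
  have "(central_proj (p i) - central_proj (p j)) \<bullet> (to_flat (p i) (u i) - to_flat (p j) (u j)) = 0"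
    if "{i, j} \<in> E" for i j
    using that graph_edge_vertices[OF assms(1) that] assms(2,3)
    by (subst edge_constraint_to_flat) (auto simp: first_order_motion_S_def)
  then show ?thesis
    by (simp add: first_order_motion_E_def ee_inner_to_flat)
qed

lemma first_order_motion_to_sphere:
  assumes "finite_graph V E" "p \<in> V \<rightarrow> upper_hemisphere"
    and "first_order_motion_E V E (central_proj \<circ> p) v"
  shows "first_order_motion_S V E p (\<lambda>i. to_sphere (p i) (v i))"
proof -
  have "p i \<bullet> to_sphere (p j) (v j) + p j \<bullet> to_sphere (p i) (v i) = 0" if "{i, j} \<in> E" for i j
    using that graph_edge_vertices[OF assms(1) that] assms(2,3)
    by (subst edge_constraint_to_sphere) (auto simp: first_order_motion_E_def)
  moreover have "p k \<bullet> to_sphere (p k) (v k) = 0" if "k \<in> V" for k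
    using that assms(2) by (auto intro: inner_to_sphere hemisphere_height_pos)
  ultimately show ?thesis
    by (simp add: first_order_motion_S_def)
qed

section \<open>Trivial motions\<close>

lemma central_proj_in_affine_space:
  "x \<in> upper_hemisphere \<Longrightarrow> central_proj x \<in> affine_space"
  by (simp add: upper_hemisphere_def affine_space_def central_proj_def)

lemma sgn_in_hemisphere:
  assumes "y \<in> affine_space"
  shows "sgn y \<in> upper_hemisphere"
proof -
  have "y \<noteq> 0"
    using assms by (auto simp: affine_space_def)
  then have "sgn y \<bullet> sgn y = 1"
    by (simp add: norm_sgn flip: power2_norm_eq_inner)
  with \<open>y \<noteq> 0\<close> assms show ?thesis
    by (simp add: affine_space_def upper_hemisphere_def sgn_div_norm)
qed

lemma central_proj_sgn:
  assumes "y \<in> affine_space"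
  shows "central_proj (sgn y) = y"
proof -
  have "y \<noteq> 0"
    using assms by (auto simp: affine_space_def)
  with assms show ?thesis
    by (simp add: affine_space_def central_proj_def sgn_div_norm)
qed

lemma sgn_central_proj:
  assumes "x \<in> upper_hemisphere"
  shows "sgn (central_proj x) = x"
proof -
  have "norm x = 1"
    using assms by (simp add: upper_hemisphere_def norm_eq_1)
  with assms show ?thesis
    by (simp add: upper_hemisphere_def central_proj_def sgn_div_norm)
qed

lemma trivial_motion_to_flat:
  assumes "trivial_motion_S w"
  shows "trivial_motion_E (\<lambda>y. to_flat (sgn y) (w (sgn y)))"
proof -
  have "(x - y) \<bullet> (to_flat (sgn x) (w (sgn x)) - to_flat (sgn y) (w (sgn y))) = 0"
    if "x \<in> affine_space" "y \<in> affine_space" for x y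
    using edge_constraint_to_flat[of "sgn x" "sgn y" "w (sgn x)" "w (sgn y)"] that assms
    by (auto simp: sgn_in_hemisphere central_proj_sgn trivial_motion_S_def)
  then show ?thesis
    by (simp add: trivial_motion_E_def ee_inner_to_flat)
qed

lemma trivial_motion_to_sphere:
  assumes "trivial_motion_E w"
  shows "trivial_motion_S (\<lambda>x. to_sphere x (w (central_proj x)))"
proof -
  have "x \<bullet> to_sphere y (w (central_proj y)) + y \<bullet> to_sphere x (w (central_proj x)) = 0"
    if "x \<in> upper_hemisphere" "y \<in> upper_hemisphere" for x y
    using that assms
    by (subst edge_constraint_to_sphere)
      (auto simp: central_proj_in_affine_space trivial_motion_E_def)
  then show ?thesis
    by (simp add: trivial_motion_S_def inner_to_sphere hemisphere_height_pos)
qed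

section \<open>Transfer of rigidity\<close>

theorem mainTheorem2:
  fixes V :: "'v set" and E :: "'v set set"
    and p :: "'v \<Rightarrow> (real ^ 'n) \<times> real"
  assumes "finite_graph V E"
    and "p \<in> V \<rightarrow> upper_hemisphere"
  shows "first_order_rigid_S V E p \<longleftrightarrow> first_order_rigid_E V E (central_proj \<circ> p)"
proof
  assume rigid: "first_order_rigid_S V E p"
  show "first_order_rigid_E V E (central_proj \<circ> p)"
    unfolding first_order_rigid_E_def
  proof (intro allI impI)
    fix v assume v: "first_order_motion_E V E (central_proj \<circ> p) v"
    obtain w where w: "trivial_motion_S w" "\<And>i. i \<in> V \<Longrightarrow> to_sphere (p i) (v i) = w (p i)"
      using rigid first_order_motion_to_sphere[OF assms v] unfolding first_order_rigid_S_def by blast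
    have "v i = to_flat (sgn (central_proj (p i))) (w (sgn (central_proj (p i))))"
      if "i \<in> V" for i
    proof -
      have "p i \<in> upper_hemisphere" "ee \<bullet> v i = 0"
        using that assms(2) v by (auto simp: first_order_motion_E_def)
      then show ?thesis
        using to_flat_to_sphere[of "p i" "v i"] w(2)[OF that]
        by (simp add: sgn_central_proj hemisphere_height_pos)
    qed
    with trivial_motion_to_flat[OF w(1)]
    show "\<exists>w. trivial_motion_E w \<and> (\<forall>i\<in>V. v i = w ((central_proj \<circ> p) i))"
      by (intro exI[of _ "\<lambda>y. to_flat (sgn y) (w (sgn y))"]) simp
  qed
next
  assume rigid: "first_order_rigid_E V E (central_proj \<circ> p)"
  show "first_order_rigid_S V E p"
    unfolding first_order_rigid_S_def
  proof (intro allI impI)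
    fix u assume u: "first_order_motion_S V E p u"
    obtain w where w: "trivial_motion_E w"
      "\<And>i. i \<in> V \<Longrightarrow> to_flat (p i) (u i) = w (central_proj (p i))"
      using rigid first_order_motion_to_flat[OF assms u]
      unfolding first_order_rigid_E_def comp_def by blast
    have "u i = to_sphere (p i) (w (central_proj (p i)))" if "i \<in> V" for i
    proof -
      have "p i \<in> upper_hemisphere" "p i \<bullet> u i = 0"
        using that assms(2) u by (auto simp: first_order_motion_S_def)
      then show ?thesis
        using to_sphere_to_flat[of "p i" "u i"] w(2)[OF that]
        by (simp add: hemisphere_height_pos)
    qed
    with trivial_motion_to_sphere[OF w(1)]
    show "\<exists>w. trivial_motion_S w \<and> (\<forall>i\<in>V. u i = w (p i))"
      by (intro exI[of _ "\<lambda>x. to_sphere x (w (central_proj x))"]) simp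
  qed
qed

end
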